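(* Let $(\Omega,\mathcal F,\mu,T)$ be a measure-preserving dynamical system ($\mu$ a probability measure), let $\mathcal A$ be a countable set, let $X:\Omega\to\mathcal A$ be $\mathcal F$-measurable, and for $k\in\mathbb N$ put $X_k\coloneqq X\circ T^{k-1}$. For $n\in\mathbb N$, $\omega\in\Omega$, $m\in\mathcal A$ define $$L_n(\omega,m)\coloneqq\max_{0\le j\le n-1}\sum_{k=1}^{n-j}\prod_{i=1}^k\mathbf 1_{X_{j+i}(\omega)=m},\qquad R_n(\omega)\coloneqq\max_{m\in\mathcal A}L_n(\omega,m),$$ i.e. the length of the longest consecutive run of the symbol $m$ (resp. of any single symbol) among $X_1(\omega),\dots,X_n(\omega)$. For $m\in\mathcal A$ and $k\in\mathbb N$ let $\Delta_k(m)\coloneqq\bigcap_{j=1}^k\{\omega\in\Omega: X_j(\omega)=m\}$. Fix $\rho>1$. Suppose (mixing) there exist $C_0>0$ and $\theta\in(0,1)$ such that for all $r,g\ge1$, all $A\in\sigma(X_1,\dots,X_r)$ and all $B\in\sigma(X_{r+g+1},X_{r+g+2},\dots)$, $$|\mu(A\cap B)-\mu(A)\mu(B)|\le C_0\theta^g\mu(A)\mu(B).$$ (1) Suppose moreover there exist $m_*\in\mathcal A$ and $c_-,c_+>0$ such that $c_-\rho^{-2k}\le\mu(\Delta_k(m_* ))\le c_+\rho^{-2k}$ for all $k\in\mathbb N$. Then for every $c>1/2$ and $\mu$-almost every $\omega\in\Omega$ there exists $n_{c,\omega}\in\mathbb N$ such that for all $n\ge n_{c,\omega}$, $$\left|L_n(\omega,m_*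 )-\frac{\log n}{2\log\rho}\right|\le\frac{c\log\log n}{\log\rho}.$$ (2) Suppose, in addition to the hypothesis of (1), there exists $C_1>0$ such that $\sum_{m\in\mathcal A}\mu(\Delta_k(m))\le C_1\rho^{-2k}$ for all $k\in\mathbb N$. Then for every $c>1/2$ and $\mu$-almost every $\omega\in\Omega$ there exists $n_{c,\omega}\in\mathbb N$ such that for all $n\ge n_{c,\omega}$, $$\left|R_n(\omega)-\frac{\log n}{2\log\rho}\right|\le\frac{c\log\log n}{\log\rho}.$$
   Context: $\mathbb N=\{1,2,\dots\}$. Measure-preserving means $\mu(T^{-1}A)=\mu(A)$ for all $A\in\mathcal F$. *)

theory Defs
  imports "HOL-Probability.Probability"
begin

definition measure_preserving_map :: "'w measure \<Rightarrow> ('w \<Rightarrow> 'w) \<Rightarrow> bool" where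
  "measure_preserving_map M T \<longleftrightarrow>
     T \<in> measurable M M \<and> (\<forall>A\<in>sets M. measure M (T -` A \<inter> space M) = measure M A)"

text \<open>Indices start at 1; the value at \<open>k = 0\<close> is never used.\<close>

definition proc :: "('w \<Rightarrow> 'w) \<Rightarrow> ('w \<Rightarrow> 'a) \<Rightarrow> nat \<Rightarrow> 'w \<Rightarrow> 'a" where
  "proc T X k \<omega> = X ((T ^^ (k - 1)) \<omega>)"

text \<open>The sigma-algebra on \<open>space M\<close> generated by \<open>Y i\<close>, \<open>i \<in> I\<close>, where the
  countable state space \<open>S\<close> carries its discrete sigma-algebra.\<close>

definition gen_sigma :: "'w measure \<Rightarrow> 'a set \<Rightarrow> (nat \<Rightarrow> 'w \<Rightarrow> 'a) \<Rightarrow> nat set \<Rightarrow> 'w set set" where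
  "gen_sigma M S Y I = sigma_sets (space M) {Y i -` B \<inter> space M | i B. i \<in> I \<and> B \<subseteq> S}"

definition run_length :: "('w \<Rightarrow> 'w) \<Rightarrow> ('w \<Rightarrow> 'a) \<Rightarrow> nat \<Rightarrow> 'w \<Rightarrow> 'a \<Rightarrow> nat" where
  "run_length T X n \<omega> m =
     Max ((\<lambda>j. \<Sum>k=1..n-j. \<Prod>i=1..k. of_bool (proc T X (j + i) \<omega> = m)) ` {0..n-1})"

text \<open>The state space may be infinite, but the set of which the maximum is taken
  is finite, since run lengths are at most \<open>n\<close>; see \<open>finite_run_lengths\<close> below.\<close>

definition max_run_length :: "'a set \<Rightarrow> ('w \<Rightarrow> 'w) \<Rightarrow> ('w \<Rightarrow> 'a) \<Rightarrow> nat \<Rightarrow> 'w \<Rightarrow> nat" where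
  "max_run_length S T X n \<omega> = Max ((\<lambda>m. run_length T X n \<omega> m) ` S)"

definition cyl :: "'w measure \<Rightarrow> ('w \<Rightarrow> 'w) \<Rightarrow> ('w \<Rightarrow> 'a) \<Rightarrow> nat \<Rightarrow> 'a \<Rightarrow> 'w set" where
  "cyl M T X k m = (\<Inter>j\<in>{1..k}. {\<omega> \<in> space M. proc T X j \<omega> = m})"

definition mixing :: "'w measure \<Rightarrow> 'a set \<Rightarrow> (nat \<Rightarrow> 'w \<Rightarrow> 'a) \<Rightarrow> bool" where
  "mixing M S Y \<longleftrightarrow>
     (\<exists>C0>0. \<exists>\<theta>\<in>{0<..<1::real}. \<forall>r\<ge>1. \<forall>g\<ge>1.
        \<forall>A\<in>gen_sigma M S Y {1..r}. \<forall>B\<in>gen_sigma M S Y {r+g+1..}.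
          \<bar>measure M (A \<inter> B) - measure M A * measure M B\<bar>
            \<le> C0 * \<theta> ^ g * measure M A * measure M B)"

definition cyl_decay :: "'w measure \<Rightarrow> ('w \<Rightarrow> 'w) \<Rightarrow> ('w \<Rightarrow> 'a) \<Rightarrow> real \<Rightarrow> 'a \<Rightarrow> bool" where
  "cyl_decay M T X \<rho> m \<longleftrightarrow>
     (\<exists>cm>0. \<exists>cp>0. \<forall>k\<ge>1.
        cm * \<rho> powr (-2 * real k) \<le> measure M (cyl M T X k m) \<and>
        measure M (cyl M T X k m) \<le> cp * \<rho> powr (-2 * real k))"

text \<open>The sum over the state space is an unconditional real sum; it always
  converges, see \<open>summable_cyl\<close> below, so the default value of \<open>infsum\<close> plays no role.\<close>

definition cyl_sum_decay :: "'w measure \<Rightarrow> 'a set \<Rightarrow> ('w \<Rightarrow> 'w) \<Rightarrow> ('w \<Rightarrow> 'a) \<Rightarrow> real \<Rightarrow> bool" where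
  "cyl_sum_decay M S T X \<rho> \<longleftrightarrow>
     (\<exists>C1>0. \<forall>k\<ge>1. (\<Sum>\<^sub>\<infinity>m\<in>S. measure M (cyl M T X k m)) \<le> C1 * \<rho> powr (-2 * real k))"

lemma run_length_le: "run_length T X n \<omega> m \<le> n"
proof -
  have "(\<Sum>k=1..n-j. \<Prod>i=1..k. of_bool (proc T X (j + i) \<omega> = m)) \<le> n" for j
  proof -
    have "(\<Sum>k=1..n-j. \<Prod>i=1..k. of_bool (proc T X (j + i) \<omega> = m)) \<le> (\<Sum>k=1..n-j. (1::nat))"
      by (intro sum_mono prod_le_1) auto
    then show ?thesis by simp
  qed
  then show ?thesis
    unfolding run_length_def by (subst Max_le_iff) auto
qed

lemma finite_run_lengths: "finite ((\<lambda>m. run_length T X n \<omega> m) ` S)"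
  by (rule finite_subset[of _ "{..n}"]) (auto simp: run_length_le)

lemma measurable_proc:
  assumes "T \<in> measurable M M" "X \<in> measurable M N"
  shows "proc T X k \<in> measurable M N"
proof -
  have "T ^^ j \<in> measurable M M" for j
    using assms(1) by (induction j) (auto intro: measurable_compose simp: o_def)
  then show ?thesis
    using assms(2) unfolding proc_def[abs_def] by (rule measurable_compose)
qed

lemma sets_cyl:
  assumes "T \<in> measurable M M" "X \<in> measurable M (count_space S)" "m \<in> S" "k \<ge> 1"
  shows "cyl M T X k m \<in> sets M"
proof -
  have "{\<omega> \<in> space M. proc T X j \<omega> = m} \<in> sets M" for j
  proof -
    have "proc T X j -` {m} \<inter> space M \<in> sets M"
      using measurable_proc[OF assms(1,2)] assms(3) by (intro measurable_sets) auto
    moreover have "proc T X j -` {m} \<inter> space M = {\<omega> \<in> space M. proc T X j \<omega> = m}"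
      by auto
    ultimately show ?thesis by simp
  qed
  then show ?thesis
    unfolding cyl_def using assms(4) by (intro sets.finite_INT) auto
qed

lemma summable_cyl:
  assumes "prob_space M" "T \<in> measurable M M" "X \<in> measurable M (count_space S)" "k \<ge> 1"
  shows "(\<lambda>m. measure M (cyl M T X k m)) summable_on S"
proof (rule nonneg_bdd_above_summable_on)
  interpret prob_space M by fact
  show "bdd_above (sum (\<lambda>m. measure M (cyl M T X k m)) ` {F. F \<subseteq> S \<and> finite F})"
  proof (rule bdd_aboveI2[where M = 1])
    fix F assume F: "F \<in> {F. F \<subseteq> S \<and> finite F}"
    have "disjoint_family_on (cyl M T X k) F"
      using assms(4) by (fastforce simp: disjoint_family_on_def cyl_def)
    moreover have "cyl M T X k ` F \<subseteq> sets M"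
      using F sets_cyl[OF assms(2,3) _ assms(4)] by auto
    ultimately have "(\<Sum>m\<in>F. measure M (cyl M T X k m)) = measure M (\<Union>m\<in>F. cyl M T X k m)"
      using F by (intro finite_measure_finite_Union[symmetric]) auto
    then show "(\<Sum>m\<in>F. measure M (cyl M T X k m)) \<le> 1"
      by simp
  qed
qed simp

end

theory Submission
  imports Defs "HOL-Real_Asymp.Real_Asymp"
begin

text \<open>
  A run of length at least \<open>k\<close> starts at a given place with probability of order
  \<open>\<rho> powr (-2 * k)\<close>, so the union bound gives probability \<open>O(n * \<rho> powr (-2 * k))\<close>
  for a run of length \<open>k\<close> before time \<open>n\<close>. For the lower bound, take about
  \<open>n / (D * k)\<close> blocks of length \<open>k\<close> whose gaps are proportional to \<open>k\<close>, with a constant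
  so large that the mixing error per block is at most half the probability of a
  run filling it: the probability that no block is a run is then at most
  \<open>exp (- a * \<rho> powr (-2 * k) * n / k)\<close> up to a constant. Inserting
  \<open>k = ln n / (2 * ln \<rho>) \<plusminus> c * ln (ln n) / ln \<rho>\<close> along \<open>n = 2 ^ i\<close>, the two bounds are of order
  \<open>i powr (-2 * c)\<close> and \<open>exp (- b * i powr (2 * c - 1))\<close>; both are summable because \<open>c > 1/2\<close>.
  Borel-Cantelli and the monotonicity of run lengths in \<open>n\<close> conclude.
\<close>

section \<open>Run lengths as statements about windows of equal symbols\<close>

text \<open>Each product is the indicator that \<open>P\<close> holds on \<open>{1..l}\<close>, so
  the sum counts an initial segment of \<open>{1..N}\<close>, namely the prefixes on which
  \<open>P\<close> holds throughout.\<close>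

lemma inner_run_ge_iff:
  assumes "k \<ge> 1"
  shows "k \<le> (\<Sum>l=1..N. \<Prod>i=1..l. of_bool (P i) :: nat) \<longleftrightarrow> k \<le> N \<and> (\<forall>i\<in>{1..k}. P i)"
proof -
  define A where "A = {l\<in>{1..N}. \<forall>i\<in>{1..l}. P i}"
  have "(\<Prod>i=1..l. of_bool (P i) :: nat) = of_bool (\<forall>i\<in>{1..l}. P i)" for l
    by (cases "\<forall>i\<in>{1..l}. P i") (auto intro: prod_zero)
  then have eq: "(\<Sum>l=1..N. \<Prod>i=1..l. of_bool (P i) :: nat) = card A"
    by (simp add: A_def sum.If_cases of_bool_def Int_def)
  show ?thesis
  proof
    assume "k \<le> (\<Sum>l=1..N. \<Prod>i=1..l. of_bool (P i) :: nat)"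
    then have "k \<le> card A" using eq by simp
    \<comment> \<open>\<open>{1..<k}\<close> has only \<open>k - 1\<close> elements, so
      \<open>A\<close> must reach some \<open>l \<ge> k\<close>; this single \<open>l\<close>
      already gives both claims.\<close>
    have "\<not> A \<subseteq> {1..<k}"
      using card_mono[of "{1..<k}" A] \<open>k \<le> card A\<close> assms by auto
    then obtain l where "l \<in> A" "l \<ge> k" by (force simp: A_def)
    then show "k \<le> N \<and> (\<forall>i\<in>{1..k}. P i)" by (auto simp: A_def)
  next
    assume "k \<le> N \<and> (\<forall>i\<in>{1..k}. P i)"
    then have "{1..k} \<subseteq> A" by (auto simp: A_def)
    then have "k \<le> card A" using card_mono[of A "{1..k}"] by (simp add: A_def)
    then show "k \<le> (\<Sum>l=1..N. \<Prod>i=1..l. of_bool (P i) :: nat)" using eq by simp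
  qed
qed

text \<open>This turns the numerical maximum into the existence of a window, the form in which
  events are written as unions over places. Since \<open>k \<ge> 1\<close>, the condition
  \<open>j + k \<le> n\<close> forces \<open>j \<le> n - 1\<close>, the range of the
  maximum.\<close>

lemma run_length_ge_iff:
  assumes "k \<ge> 1"
  shows "k \<le> run_length T X n \<omega> m \<longleftrightarrow> (\<exists>j. j + k \<le> n \<and> (\<forall>i\<in>{1..k}. proc T X (j + i) \<omega> = m))"
proof -
  have "k \<le> run_length T X n \<omega> m \<longleftrightarrow>
      (\<exists>j\<in>{0..n-1}. k \<le> n - j \<and> (\<forall>i\<in>{1..k}. proc T X (j + i) \<omega> = m))"
    unfolding run_length_def by (subst Max_ge_iff) (auto simp: inner_run_ge_iff[OF assms, unfolded One_nat_def])
  also have "\<dots> \<longleftrightarrow> (\<exists>j. j + k \<le> n \<and> (\<forall>i\<in>{1..k}. proc T X (j + i) \<omega> = m))"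
    using assms by (intro iffI; elim bexE exE; intro bexI exI) auto
  finally show ?thesis .
qed

lemma run_length_mono:
  assumes "n \<le> n'"
  shows "run_length T X n \<omega> m \<le> run_length T X n' \<omega> m"
proof (cases "run_length T X n \<omega> m")
  case (Suc l)
  then have "Suc l \<le> run_length T X n \<omega> m" by simp
  with assms have "Suc l \<le> run_length T X n' \<omega> m"
    by (subst (asm) run_length_ge_iff, simp, subst run_length_ge_iff, simp) (meson le_trans)
  then show ?thesis using Suc by simp
qed simp

lemma max_run_length_ge_iff:
  assumes "S \<noteq> {}"
  shows "k \<le> max_run_length S T X n \<omega> \<longleftrightarrow> (\<exists>m\<in>S. k \<le> run_length T X n \<omega> m)"
  unfolding max_run_length_def using assms finite_run_lengths[of T X n \<omega> S]
  by (subst Max_ge_iff) auto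

lemma max_run_length_mono:
  assumes "S \<noteq> {}" "n \<le> n'"
  shows "max_run_length S T X n \<omega> \<le> max_run_length S T X n' \<omega>"
  using max_run_length_ge_iff[OF assms(1)] run_length_mono[OF assms(2)] by (meson le_refl le_trans)

section \<open>From tail bounds to almost sure bounds along powers of two\<close>

text \<open>Stated for any monotone family \<open>L\<close>, so that it serves both a fixed symbol
  and the maximum over symbols. The event \<open>E i\<close> looks at the right end
  \<open>2 ^ Suc i\<close> of a dyadic interval but uses the threshold of its left end, so one event
  controls the whole interval; this costs only a factor 2 in probability.\<close>

lemma (in prob_space) AE_eventually_le:
  fixes L :: "nat \<Rightarrow> 'a \<Rightarrow> nat"
  assumes rho: "\<rho> > 1" and c: "c > 1/2"
    and mono: "\<And>n n' \<omega>. n \<le> n' \<Longrightarrow> L n \<omega> \<le> L n' \<omega>"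
    and meas: "\<And>n k. k \<ge> 1 \<Longrightarrow> {\<omega>\<in>space M. k \<le> L n \<omega>} \<in> events"
    and bound: "\<And>n k. k \<ge> 1 \<Longrightarrow> prob {\<omega>\<in>space M. k \<le> L n \<omega>} \<le> C * real n * \<rho> powr (-2 * real k)"
    and C: "C > 0"
  shows "AE \<omega> in M. \<forall>\<^sub>F n in sequentially.
           real (L n \<omega>) \<le> ln (real n) / (2 * ln \<rho>) + c * ln (ln (real n)) / ln \<rho>"
proof -
  have lr: "ln \<rho> > 0" using rho by simp
  define f where "f = (\<lambda>x::real. ln x / (2 * ln \<rho>) + c * ln (ln x) / ln \<rho>)"
  have f_mono: "f x \<le> f y" if "2 \<le> x" "x \<le> y" for x y
    unfolding f_def using that lr c
    by (intro add_mono divide_right_mono mult_left_mono) (auto intro!: ln_mono)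
  define k where "k = (\<lambda>i::nat. nat \<lceil>f (2 ^ i)\<rceil>)"
  \<comment> \<open>The \<open>max 1\<close> makes \<open>meas\<close> applicable for every
    \<open>i\<close>; it has no effect once \<open>f (2 ^ i) > 0\<close>.\<close>
  define E where "E = (\<lambda>i. {\<omega>\<in>space M. max 1 (k i) \<le> L (2 ^ Suc i) \<omega>})"
  have E: "E i \<in> events" for i unfolding E_def by (rule meas) simp
  have f_ge: "\<forall>\<^sub>F i in sequentially. f (2 ^ i) > 0"
    unfolding f_def using lr c by real_asymp
  have "\<forall>\<^sub>F i in sequentially. norm (prob (E i)) \<le> 2 * C * ln 2 powr (-2*c) * real i powr (-2 * c)"
    using f_ge eventually_gt_at_top[of 0]
  proof eventually_elim
    case (elim i)
    have k: "real (k i) \<ge> f (2 ^ i)" "k i \<ge> 1" using elim by (auto simp: k_def) linarith+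
    have "prob (E i) \<le> C * real (2 ^ Suc i) * \<rho> powr (-2 * real (k i))"
      using bound[of "k i" "2 ^ Suc i"] k by (simp add: E_def max_def)
    also have "\<rho> powr (-2 * real (k i)) \<le> \<rho> powr (-2 * f (2 ^ i))"
      using k rho by (intro powr_mono) auto
    \<comment> \<open>The leading term of \<open>f\<close> gives the factor
      \<open>1 / 2 ^ i\<close>, which cancels the time horizon; the correction leaves
      \<open>i powr (-2 * c)\<close>.\<close>
    also have "\<rho> powr (-2 * f (2 ^ i)) = exp (- ln (2 ^ i) + (-2*c) * ln (real i * ln 2))"
      using rho lr by (simp add: f_def powr_def field_simps ln_realpow)
    also have "\<dots> = 1 / 2 ^ i * (real i powr (-2*c) * ln 2 powr (-2*c))"
      unfolding exp_add using elim by (simp add: exp_minus powr_def ln_mult field_simps flip: exp_add)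
    finally show ?case using C by (simp add: field_simps)
  qed
  moreover have "summable (\<lambda>i. 2 * C * ln 2 powr (-2*c) * real i powr (-2 * c))"
    using c by (intro summable_mult) (simp add: summable_real_powr_iff)
  ultimately have "summable (\<lambda>i. prob (E i))"
    by (rule summable_comparison_test_ev)
  then have "AE \<omega> in M. \<forall>\<^sub>F i in sequentially. \<omega> \<in> space M - E i"
    using E by (intro borel_cantelli_AE1) (auto simp: emeasure_eq_measure)
  then show ?thesis
  proof eventually_elim
    case (elim \<omega>)
    then have "\<forall>\<^sub>F i in sequentially. \<omega> \<in> space M - E i \<and> f (2 ^ i) > 0 \<and> i \<ge> 1"
      using f_ge eventually_ge_at_top[of 1] by eventually_elim auto
    then obtain i0 where i0: "\<And>i. i \<ge> i0 \<Longrightarrow> \<omega> \<in> space M - E i \<and> f (2 ^ i) > 0 \<and> i \<ge> 1"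
      unfolding eventually_sequentially by blast
    have "real (L n \<omega>) \<le> f (real n)" if n: "n \<ge> 2 ^ i0" for n
    proof -
      have "n \<ge> 1" using n by (meson le_trans one_le_numeral one_le_power)
      then obtain i where i: "2 ^ i \<le> n" "n < 2 ^ Suc i"
        using ex_power_ivl1[of 2 n] by auto
      have "i0 \<le> i"
      proof (rule ccontr)
        assume "\<not> i0 \<le> i"
        then have "(2::nat) ^ Suc i \<le> 2 ^ i0" by (intro power_increasing) auto
        then show False using i n by linarith
      qed
      note * = i0[OF this]
      then have "1 \<le> k i" unfolding k_def by linarith
      with * have "L (2 ^ Suc i) \<omega> < k i" by (auto simp: E_def max_def not_le)
      moreover have "L n \<omega> \<le> L (2 ^ Suc i) \<omega>" using i by (intro mono) auto
      \<comment> \<open>Rounding up loses nothing: an integer below the ceiling of a number is below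
        the number itself.\<close>
      ultimately have "real (L n \<omega>) < f (2 ^ i)" unfolding k_def by linarith
      also have "f (2 ^ i) \<le> f (real n)"
      proof (rule f_mono)
        show "(2::real) \<le> 2 ^ i" using * by (metis power_increasing one_le_numeral power_one_right)
        show "(2::real) ^ i \<le> real n" using i(1) by (metis of_nat_le_iff of_nat_numeral of_nat_power)
      qed
      finally show ?thesis by simp
    qed
    then show ?case unfolding f_def eventually_sequentially by blast
  qed
qed

text \<open>The mirror image: monotonicity now passes from the left end \<open>2 ^ i\<close> to
  later \<open>n\<close>, so the threshold must dominate the claimed lower bound on the whole dyadic
  interval.\<close>

lemma (in prob_space) AE_eventually_ge:
  fixes L :: "nat \<Rightarrow> 'a \<Rightarrow> nat"
  assumes rho: "\<rho> > 1" and c: "c > 1/2"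
    and mono: "\<And>n n' \<omega>. n \<le> n' \<Longrightarrow> L n \<omega> \<le> L n' \<omega>"
    and meas: "\<And>n k. k \<ge> 1 \<Longrightarrow> {\<omega>\<in>space M. L n \<omega> < k} \<in> events"
    and bound: "\<And>n k. k \<ge> 1 \<Longrightarrow>
      prob {\<omega>\<in>space M. L n \<omega> < k} \<le> C * exp (- a * \<rho> powr (-2 * real k) * real n / real k)"
    and C: "C > 0" and a: "a > 0"
  shows "AE \<omega> in M. \<forall>\<^sub>F n in sequentially.
           real (L n \<omega>) \<ge> ln (real n) / (2 * ln \<rho>) - c * ln (ln (real n)) / ln \<rho>"
proof -
  have lr: "ln \<rho> > 0" using rho by simp
  \<comment> \<open>The positive term is taken at \<open>n = 2 ^ Suc i\<close>, the subtracted one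
    at \<open>n = 2 ^ i\<close>; hence \<open>f i\<close> is at least the lower bound at every
    \<open>n\<close> in between.\<close>
  define f where "f = (\<lambda>i. real (Suc i) * ln 2 / (2 * ln \<rho>) - c * ln (real i * ln 2) / ln \<rho>)"
  define B where "B = ln 2 / ln \<rho>"
  have B: "B > 0" using lr by (simp add: B_def)
  define k where "k = (\<lambda>i::nat. nat \<lceil>f i\<rceil>)"
  define E where "E = (\<lambda>i. {\<omega>\<in>space M. L (2 ^ i) \<omega> < max 1 (k i)})"
  have E: "E i \<in> events" for i unfolding E_def by (rule meas) simp
  have f_pos: "\<forall>\<^sub>F i in sequentially. f i > 0"
    unfolding f_def using lr c by real_asymp
  have f_le: "\<forall>\<^sub>F i in sequentially. f i + 1 \<le> B * real i"
  proof -
    have "\<forall>\<^sub>F i in sequentially. 0 \<le> c * ln (real i * ln 2) / ln \<rho>"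
      using lr c by real_asymp
    moreover have "\<forall>\<^sub>F i in sequentially. B / 2 + 1 \<le> B / 2 * real i"
      using B by real_asymp
    ultimately show ?thesis
    proof eventually_elim
      case (elim i)
      have "f i = B / 2 * real i + B / 2 - c * ln (real i * ln 2) / ln \<rho>"
        by (simp add: f_def B_def add_divide_distrib distrib_right mult_ac)
      then show ?case using elim by simp
    qed
  qed
  \<comment> \<open>\<open>\<rho> powr (-2)\<close> pays for rounding \<open>f i\<close> up, the 2
    for \<open>Suc i\<close> in place of \<open>i\<close>, and \<open>B\<close> for the denominator,
    as \<open>k i \<le> B * real i\<close>.\<close>
  define b where "b = a * \<rho> powr (-2) * ln 2 powr (2 * c) / (2 * B)"
  have b: "b > 0" using a rho B by (simp add: b_def)
  have "\<forall>\<^sub>F i in sequentially. norm (prob (E i)) \<le> C * exp (- b * real i powr (2 * c - 1))"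
    using f_pos f_le eventually_gt_at_top[of 0]
  proof eventually_elim
    case (elim i)
    have k: "real (k i) \<le> f i + 1" "k i \<ge> 1" using elim by (auto simp: k_def) linarith+
    have "-2 * (f i + 1) * ln \<rho> = -2 * ln \<rho> + (- ln (2 ^ Suc i) + (2*c) * ln (real i * ln 2))"
      using lr ln_realpow[of 2 "Suc i"] by (simp add: f_def field_simps del: power_Suc)
    then have "\<rho> powr (-2 * (f i + 1)) = \<rho> powr (-2) * exp (- ln (2 ^ Suc i) + (2*c) * ln (real i * ln 2))"
      using rho unfolding powr_def by (simp add: mult_exp_exp)
    also have "\<dots> = \<rho> powr (-2) * (1 / 2 ^ Suc i * (real i powr (2*c) * ln 2 powr (2*c)))"
      using elim powr_mult[of "real i" "ln 2" "2 * c"]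
      by (simp add: exp_diff powr_def)
    finally have eq: "\<rho> powr (-2 * (f i + 1)) * 2 ^ i / (B * real i) * a
        = b * (real i powr (2 * c) / real i)"
      using elim B by (simp add: b_def field_simps)
    have "b * real i powr (2 * c - 1) = b * (real i powr (2 * c) / real i)"
      using elim by (simp add: powr_diff)
    also have "\<dots> = \<rho> powr (-2 * (f i + 1)) * 2 ^ i / (B * real i) * a" using eq by simp
    also have "\<dots> \<le> \<rho> powr (-2 * real (k i)) * 2 ^ i / real (k i) * a"
      using k rho elim a B by (intro mult_right_mono frac_le mult_right_mono powr_mono) auto
    finally have ex: "b * real i powr (2 * c - 1) \<le> a * \<rho> powr (-2 * real (k i)) * 2 ^ i / real (k i)"
      by (simp add: mult_ac)
    have "prob (E i) \<le> C * exp (- a * \<rho> powr (-2 * real (k i)) * real (2 ^ i) / real (k i))"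
      using bound[of "k i" "2 ^ i"] k by (simp add: E_def max_def)
    also have "\<dots> \<le> C * exp (- b * real i powr (2 * c - 1))"
      using ex C by (intro mult_left_mono) auto
    finally show ?case by simp
  qed
  moreover have "summable (\<lambda>i. C * exp (- b * real i powr (2 * c - 1)))"
  \<comment> \<open>Since \<open>2 * c - 1 > 0\<close>, the stretched exponential decays faster than
    any power of \<open>i\<close>.\<close>
  proof -
    have "(\<lambda>i. exp (- b * real i powr (2 * c - 1))) \<in> O(\<lambda>i. real i powr (-2))"
      using b c by real_asymp
    then have "summable (\<lambda>i. exp (- b * real i powr (2 * c - 1)))"
      by (rule summable_comparison_test_bigo[rotated]) (simp add: summable_real_powr_iff)
    then show ?thesis by (rule summable_mult)
  qed
  ultimately have "summable (\<lambda>i. prob (E i))"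
    by (rule summable_comparison_test_ev)
  then have "AE \<omega> in M. \<forall>\<^sub>F i in sequentially. \<omega> \<in> space M - E i"
    using E by (intro borel_cantelli_AE1) (auto simp: emeasure_eq_measure)
  then show ?thesis
  proof eventually_elim
    case (elim \<omega>)
    then have "\<forall>\<^sub>F i in sequentially. \<omega> \<in> space M - E i \<and> f i > 0 \<and> i \<ge> 1"
      using f_pos eventually_ge_at_top[of 1] by eventually_elim auto
    then obtain i0 where i0: "\<And>i. i \<ge> i0 \<Longrightarrow> \<omega> \<in> space M - E i \<and> f i > 0 \<and> i \<ge> 1"
      unfolding eventually_sequentially by blast
    have "real (L n \<omega>) \<ge> ln (real n) / (2 * ln \<rho>) - c * ln (ln (real n)) / ln \<rho>"
      if n: "n \<ge> 2 ^ i0" for n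
    proof -
      have "n \<ge> 1" using n by (meson le_trans one_le_numeral one_le_power)
      then obtain i where i: "2 ^ i \<le> n" "n < 2 ^ Suc i"
        using ex_power_ivl1[of 2 n] by auto
      have "i0 \<le> i"
      proof (rule ccontr)
        assume "\<not> i0 \<le> i"
        then have "(2::nat) ^ Suc i \<le> 2 ^ i0" by (intro power_increasing) auto
        then show False using i n by linarith
      qed
      note * = i0[OF this]
      have "real n \<le> real (2 ^ Suc i)" "real (2 ^ i) \<le> real n"
        using i unfolding of_nat_le_iff by auto
      then have "ln (real n) \<le> ln (2 ^ Suc i)" and ln_ge: "ln (2 ^ i) \<le> ln (real n)"
        using \<open>n \<ge> 1\<close> by (auto intro!: ln_mono)
      then have up: "ln (real n) \<le> real (Suc i) * ln 2" by (subst (asm) ln_realpow) auto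
      from ln_ge have lo: "real i * ln 2 \<le> ln (real n)" by (subst (asm) ln_realpow) auto
      have "ln (real i * ln 2) \<le> ln (ln (real n))"
        using * lo by (intro ln_mono) auto
      then have "ln (real n) / (2 * ln \<rho>) - c * ln (ln (real n)) / ln \<rho> \<le> f i"
        unfolding f_def using up lr c
        by (intro diff_mono divide_right_mono mult_left_mono) auto
      also have "f i \<le> real (k i)" unfolding k_def by linarith
      also have "k i \<le> L (2 ^ i) \<omega>" using * by (auto simp: E_def)
      also have "L (2 ^ i) \<omega> \<le> L n \<omega>" using i by (intro mono) auto
      finally show ?thesis by simp
    qed
    then show ?case unfolding eventually_sequentially by blast
  qed
qed

section \<open>Stationarity and the union bound\<close>

locale stationary_process = prob_space M for M :: "'w measure" +
  fixes T :: "'w \<Rightarrow> 'w" and S :: "'a set" and X :: "'w \<Rightarrow> 'a"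
  assumes mp: "measure_preserving_map M T"
    and countable_S: "countable S"
    and X_meas: "X \<in> measurable M (count_space S)"
begin

lemma T_meas: "T \<in> measurable M M"
  using mp by (simp add: measure_preserving_map_def)

lemma funpow_T_meas: "T ^^ j \<in> measurable M M"
  using T_meas by (induction j) (auto intro: measurable_compose simp: o_def)

lemma prob_funpow_vimage:
  assumes "A \<in> events"
  shows "prob ((T ^^ j) -` A \<inter> space M) = prob A"
proof (induction j)
  case (Suc j)
  have "(T ^^ Suc j) -` A \<inter> space M = T -` ((T ^^ j) -` A \<inter> space M) \<inter> space M"
    using measurable_space[OF T_meas] by (auto simp: funpow_Suc_right simp del: funpow.simps)
  moreover have "(T ^^ j) -` A \<inter> space M \<in> events"
    using funpow_T_meas assms by (rule measurable_sets)
  ultimately show ?case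
    using mp Suc unfolding measure_preserving_map_def by metis
qed (use assms sets.sets_into_space in \<open>simp add: Int_absorb2\<close>)

definition run_at :: "nat \<Rightarrow> nat \<Rightarrow> 'a \<Rightarrow> 'w set" where
  "run_at j k m = {\<omega>\<in>space M. \<forall>i\<in>{1..k}. proc T X (j + i) \<omega> = m}"

text \<open>Shifting the index is applying \<open>T ^^ j\<close>. The condition
  \<open>i \<ge> 1\<close> guards the truncated subtraction in \<open>proc\<close>.\<close>

lemma proc_add: "i \<ge> 1 \<Longrightarrow> proc T X (j + i) \<omega> = proc T X i ((T ^^ j) \<omega>)"
  by (simp add: proc_def add.commute[of j] flip: funpow_add[THEN fun_cong, unfolded o_apply])

lemma run_at_eq_vimage:
  assumes "k \<ge> 1"
  shows "run_at j k m = (T ^^ j) -` cyl M T X k m \<inter> space M"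
  using assms measurable_space[OF funpow_T_meas, of _ j]
  by (auto simp: run_at_def cyl_def proc_add)

lemma run_at_event: "m \<in> S \<Longrightarrow> k \<ge> 1 \<Longrightarrow> run_at j k m \<in> events"
  unfolding run_at_eq_vimage
  by (intro measurable_sets[OF funpow_T_meas] sets_cyl[OF T_meas X_meas])

lemma prob_run_at: "m \<in> S \<Longrightarrow> k \<ge> 1 \<Longrightarrow> prob (run_at j k m) = prob (cyl M T X k m)"
  by (simp add: run_at_eq_vimage prob_funpow_vimage sets_cyl[OF T_meas X_meas])

lemma run_length_ge_eq:
  assumes "k \<ge> 1"
  shows "{\<omega>\<in>space M. k \<le> run_length T X n \<omega> m} = (\<Union>j\<in>{j. j + k \<le> n}. run_at j k m)"
  using assms by (auto simp: run_at_def run_length_ge_iff)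

lemma run_length_ge_event:
  assumes "m \<in> S" "k \<ge> 1"
  shows "{\<omega>\<in>space M. k \<le> run_length T X n \<omega> m} \<in> events"
  unfolding run_length_ge_eq[OF assms(2)] using assms by (intro sets.countable_UN'') (auto simp: run_at_event)

lemma UN_cyl_event:
  assumes "S' \<subseteq> S" "k \<ge> 1"
  shows "(\<Union>m\<in>S'. cyl M T X k m) \<in> events"
  using assms countable_subset[OF _ countable_S] sets_cyl[OF T_meas X_meas]
  by (intro sets.countable_UN'') auto

text \<open>The union bound runs over the at most \<open>n\<close> starting places only, each
  equally likely by stationarity; the union over symbols stays inside the probability.
  \<open>S' = {m}\<close> serves a fixed symbol, \<open>S' = S\<close> the maximum.\<close>

lemma prob_run_length_ge_le:
  assumes "S' \<subseteq> S" "k \<ge> 1"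
  shows "prob {\<omega>\<in>space M. \<exists>m\<in>S'. k \<le> run_length T X n \<omega> m}
    \<le> real n * prob (\<Union>m\<in>S'. cyl M T X k m)" (is "_ \<le> _ * prob ?U")
proof -
  let ?V = "\<lambda>j. (T ^^ j) -` ?U \<inter> space M"
  have V: "?V j \<in> events" for j
    by (rule measurable_sets[OF funpow_T_meas UN_cyl_event[OF assms]])
  have "{\<omega>\<in>space M. \<exists>m\<in>S'. k \<le> run_length T X n \<omega> m} \<subseteq> (\<Union>j<n. ?V j)"
  proof
    fix \<omega> assume "\<omega> \<in> {\<omega>\<in>space M. \<exists>m\<in>S'. k \<le> run_length T X n \<omega> m}"
    then obtain m where m: "m \<in> S'" "\<omega> \<in> {\<omega>\<in>space M. k \<le> run_length T X n \<omega> m}" by auto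
    then obtain j where "j + k \<le> n" "\<omega> \<in> run_at j k m"
      unfolding run_length_ge_eq[OF assms(2)] by blast
    then show "\<omega> \<in> (\<Union>j<n. ?V j)" using m assms(2) by (auto simp: run_at_eq_vimage intro!: bexI[of _ j])
  qed
  then have "prob {\<omega>\<in>space M. \<exists>m\<in>S'. k \<le> run_length T X n \<omega> m} \<le> prob (\<Union>j<n. ?V j)"
    by (rule finite_measure_mono) (intro sets.finite_UN finite_lessThan V)
  also have "\<dots> \<le> (\<Sum>j<n. prob (?V j))"
    using V by (intro finite_measure_subadditive_finite) auto
  also have "\<dots> = real n * prob ?U"
    by (simp add: prob_funpow_vimage[OF UN_cyl_event[OF assms]] del: vimage_UN)
  finally show ?thesis .
qed

text \<open>As \<open>k \<ge> 1\<close>, the first symbol separates the cylinders, so countable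
  additivity applies. It is available as an integral over \<open>count_space S\<close>, which
  \<open>infsetsum\<close> links to the sum in \<open>cyl_sum_decay\<close>.\<close>

lemma prob_UN_cyl:
  assumes "k \<ge> 1"
  shows "prob (\<Union>m\<in>S. cyl M T X k m) = (\<Sum>\<^sub>\<infinity>m\<in>S. prob (cyl M T X k m))"
proof -
  have "disjoint_family_on (cyl M T X k) S"
    using assms by (fastforce simp: disjoint_family_on_def cyl_def)
  then have "emeasure M (\<Union>m\<in>S. cyl M T X k m) = (\<integral>\<^sup>+m. emeasure M (cyl M T X k m) \<partial>count_space S)"
    using sets_cyl[OF T_meas X_meas] assms by (intro emeasure_UN_countable countable_S) auto
  moreover have summ: "Infinite_Set_Sum.abs_summable_on (\<lambda>m. prob (cyl M T X k m)) S"
    using summable_cyl[OF prob_space_axioms T_meas X_meas assms] by (simp flip: abs_summable_equivalent)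
  ultimately have "ennreal (prob (\<Union>m\<in>S. cyl M T X k m)) = ennreal (infsetsum (\<lambda>m. prob (cyl M T X k m)) S)"
    by (simp add: emeasure_eq_measure nn_integral_conv_infsetsum)
  then show ?thesis
    by (subst (asm) ennreal_inj) (auto intro: infsetsum_nonneg simp flip: infsetsum_infsum[OF summ])
qed

section \<open>Separated blocks and mixing\<close>

lemma gen_sigma_algebra: "sigma_algebra (space M) (gen_sigma M S (proc T X) I)"
  unfolding gen_sigma_def by (rule sigma_algebra_sigma_sets) auto

lemma run_at_compl_gen_sigma:
  assumes "m \<in> S" "k \<ge> 1" "{j+1..j+k} \<subseteq> I"
  shows "space M - run_at j k m \<in> gen_sigma M S (proc T X) I"
proof -
  interpret G: sigma_algebra "space M" "gen_sigma M S (proc T X) I" by (rule gen_sigma_algebra)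
  have "proc T X (j + i) -` {m} \<inter> space M \<in> gen_sigma M S (proc T X) I" if "i \<in> {1..k}" for i
    unfolding gen_sigma_def using that assms(1,3) by (intro sigma_sets.Basic) (auto intro!: exI[of _ "j + i"] exI[of _ "{m}"])
  then have "(\<Inter>i\<in>{1..k}. proc T X (j + i) -` {m} \<inter> space M) \<in> gen_sigma M S (proc T X) I"
    using assms(2) by (intro G.finite_INT) auto
  also have "(\<Inter>i\<in>{1..k}. proc T X (j + i) -` {m} \<inter> space M) = run_at j k m"
    using assms(2) by (auto simp: run_at_def)
  finally show ?thesis by auto
qed

text \<open>Induction on the number of blocks: the newest block is separated from all earlier ones
  by a gap of length \<open>d - k\<close>, so by \<open>mix\<close> it contributes a factor of at
  most \<open>(1 + q / 2) * (1 - q) \<le> 1 - q / 2\<close>.\<close>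

lemma prob_no_block_run_le:
  assumes m: "m \<in> S" and k: "k \<ge> 1" and d: "d > k" and q: "q = prob (cyl M T X k m)"
    and mix: "\<And>r A B. \<lbrakk>r \<ge> 1; A \<in> gen_sigma M S (proc T X) {1..r};
        B \<in> gen_sigma M S (proc T X) {r + (d - k) + 1..}\<rbrakk>
      \<Longrightarrow> prob (A \<inter> B) \<le> (1 + q / 2) * prob A * prob B"
  shows "prob {\<omega>\<in>space M. \<forall>j<N. \<omega> \<notin> run_at (j * d) k m} \<le> (1 - q / 2) ^ N"
proof (induction N)
  case (Suc N)
  define A where "A = {\<omega>\<in>space M. \<forall>j<N. \<omega> \<notin> run_at (j * d) k m}"
  define B where "B = space M - run_at (N * d) k m"
  have q01: "0 \<le> q" "q \<le> 1" using q by auto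
  have pB: "prob B = 1 - q"
    using run_at_event[OF m k] prob_run_at[OF m k] q by (simp add: B_def prob_compl)
  have AB: "{\<omega>\<in>space M. \<forall>j<Suc N. \<omega> \<notin> run_at (j * d) k m} = A \<inter> B"
    by (auto simp: A_def B_def less_Suc_eq)
  show ?case
  \<comment> \<open>The first block has no past to be mixed with and is estimated directly.\<close>
  proof (cases "N = 0")
    case True
    then have "A \<inter> B = B" by (auto simp: A_def B_def)
    then show ?thesis unfolding AB using True pB q01 by simp
  next
    case False
    \<comment> \<open>The last index of block \<open>N - 1\<close>; adding the gap gives
      \<open>N * d\<close>, so the next block starts at \<open>N * d + 1\<close>, exactly where
      \<open>mix\<close> permits.\<close>
    define r where "r = (N - 1) * d + k"
    have rd: "r + (d - k) = N * d"
      using d False by (cases N) (auto simp: r_def)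
    interpret G: sigma_algebra "space M" "gen_sigma M S (proc T X) {1..r}" by (rule gen_sigma_algebra)
    have A_eq: "A = (\<Inter>j\<in>{..<N}. space M - run_at (j * d) k m)"
      using False by (auto simp: A_def)
    have "A \<in> gen_sigma M S (proc T X) {1..r}"
      unfolding A_eq
    proof (intro G.finite_INT)
      fix j assume "j \<in> {..<N}"
      then have "j * d + k \<le> r" unfolding r_def by (intro add_right_mono mult_right_mono) auto
      then show "space M - run_at (j * d) k m \<in> gen_sigma M S (proc T X) {1..r}"
        by (intro run_at_compl_gen_sigma m k) auto
    qed (use False in auto)
    moreover have "B \<in> gen_sigma M S (proc T X) {r + (d - k) + 1..}"
      unfolding B_def rd by (intro run_at_compl_gen_sigma m k) auto
    moreover have "r \<ge> 1" using k by (simp add: r_def)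
    ultimately have "prob (A \<inter> B) \<le> (1 + q / 2) * prob A * prob B" by (intro mix)
    also have "\<dots> = ((1 + q / 2) * (1 - q)) * prob A" by (simp add: pB)
    also have "\<dots> \<le> (1 - q / 2) * (1 - q / 2) ^ N"
      using Suc q01 unfolding A_def
      by (intro mult_mono) (auto simp: field_simps)
    finally show ?thesis unfolding AB by simp
  qed
qed simp

text \<open>If the run length is below \<open>k\<close>, none of the \<open>n div d\<close> blocks
  within time \<open>n\<close> is a run. Mixing is exponential in the gap, so a gap proportional to
  \<open>k\<close> brings its error below half of a run probability of order
  \<open>\<rho> powr (-2 * real k)\<close>.\<close>

lemma prob_run_length_less_le:
  assumes mixing: "mixing M S (proc T X)" and m: "m \<in> S" and rho: "\<rho> > 1"
    and decay: "cyl_decay M T X \<rho> m"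
  shows "\<exists>C>0. \<exists>a>0. \<forall>n k. k \<ge> 1 \<longrightarrow> prob {\<omega>\<in>space M. run_length T X n \<omega> m < k}
    \<le> C * exp (- a * \<rho> powr (-2 * real k) * real n / real k)"
proof -
  obtain cm where cm: "cm > 0" "\<And>k. k \<ge> 1 \<Longrightarrow> cm * \<rho> powr (-2 * real k) \<le> prob (cyl M T X k m)"
    using decay unfolding cyl_decay_def by blast
  obtain C0 \<theta> where C0: "C0 > 0" and \<theta>: "0 < \<theta>" "\<theta> < 1" and
    mix: "\<And>r g A B. \<lbrakk>r \<ge> 1; g \<ge> 1; A \<in> gen_sigma M S (proc T X) {1..r};
        B \<in> gen_sigma M S (proc T X) {r+g+1..}\<rbrakk> \<Longrightarrow>
      \<bar>prob (A \<inter> B) - prob A * prob B\<bar> \<le> C0 * \<theta> ^ g * prob A * prob B"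
    using mixing unfolding mixing_def by auto
  \<comment> \<open>The gap \<open>2 * K * k\<close> provides \<open>(\<theta> ^ K) ^ k\<close>
    twice: one copy is at most \<open>cm / (2 * C0)\<close> and absorbs the constants, the other is
    at most \<open>(\<rho> powr (-2)) ^ k\<close>.\<close>
  define e where "e = min (\<rho> powr (-2)) (cm / (2 * C0))"
  have e: "e > 0" using rho cm C0 by (simp add: e_def)
  obtain K0 where K0: "\<theta> ^ K0 < e" using real_arch_pow_inv[OF e \<theta>(2)] by blast
  define K where "K = Suc K0"
  have K: "\<theta> ^ K \<le> e" "K \<ge> 1" using K0 \<theta> order_trans[OF mult_left_le_one_le[of "\<theta> ^ K0" \<theta>], of e] by (auto simp: K_def)
  \<comment> \<open>One \<open>k\<close> for the block and \<open>2 * K * k\<close> for the gap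
    after it.\<close>
  define D where "D = 2 * K + 1"
  have bound: "prob {\<omega>\<in>space M. run_length T X n \<omega> m < k}
      \<le> exp cm * exp (- (cm / (2 * D)) * \<rho> powr (-2 * real k) * real n / real k)" if k: "k \<ge> 1" for n k
  proof -
    define q where "q = prob (cyl M T X k m)"
    define x where "x = cm / 2 * \<rho> powr (-2 * real k)"
    have xq: "x \<le> q / 2" using cm(2)[OF k] by (simp add: x_def q_def)
    have x0: "x \<ge> 0" using cm by (simp add: x_def)
    have "\<rho> powr (-2 * real k) \<le> \<rho> powr 0" using rho by (intro powr_mono) auto
    then have x1: "x \<le> cm" using rho cm(1) by (simp add: x_def)
    define d where "d = D * k"
    define N where "N = n div d"
    have d: "d > k" "d - k = K * k + K * k" using K k by (auto simp: d_def D_def algebra_simps)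
    have "C0 * \<theta> ^ (d - k) = C0 * ((\<theta> ^ K) ^ k * (\<theta> ^ K) ^ k)"
      by (simp add: d(2) power_add power_mult)
    also have "\<dots> \<le> C0 * (e ^ 1 * (\<rho> powr (-2)) ^ k)"
    proof (intro mult_left_mono mult_mono)
      have "(\<theta> ^ K) ^ k \<le> (\<theta> ^ K) ^ 1" using \<theta> k by (intro power_decreasing) (auto simp: power_le_one)
      then show "(\<theta> ^ K) ^ k \<le> e ^ 1" using K by simp
      show "(\<theta> ^ K) ^ k \<le> (\<rho> powr (-2)) ^ k" using K \<theta> by (intro power_mono) (auto simp: e_def)
    qed (use \<theta> C0 e in auto)
    also have "\<dots> \<le> C0 * (cm / (2 * C0) * (\<rho> powr (-2)) ^ k)"
      using C0 rho by (intro mult_left_mono mult_right_mono) (auto simp: e_def)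
    also have "(\<rho> powr (-2)) ^ k = \<rho> powr (-2 * real k)"
      using rho by (simp add: powr_powr flip: powr_realpow)
    also have "C0 * (cm / (2 * C0) * \<rho> powr (-2 * real k)) = x" using C0 by (simp add: x_def)
    finally have small: "C0 * \<theta> ^ (d - k) \<le> q / 2" using xq by simp
    have "{\<omega>\<in>space M. run_length T X n \<omega> m < k} \<subseteq> {\<omega>\<in>space M. \<forall>j<N. \<omega> \<notin> run_at (j * d) k m}"
    proof safe
      fix \<omega> j assume *: "\<omega> \<in> space M" "run_length T X n \<omega> m < k" "j < N" "\<omega> \<in> run_at (j * d) k m"
      have "j * d + k \<le> Suc j * d" using d by simp
      also have "\<dots> \<le> N * d" using * by (intro mult_right_mono) auto
      also have "\<dots> \<le> n" by (simp add: N_def)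
      finally have "k \<le> run_length T X n \<omega> m"
        using * run_length_ge_eq[OF k, of n m] by blast
      then show False using * by simp
    qed
    then have "prob {\<omega>\<in>space M. run_length T X n \<omega> m < k}
        \<le> prob {\<omega>\<in>space M. \<forall>j<N. \<omega> \<notin> run_at (j * d) k m}"
      by (intro finite_measure_mono) (use run_at_event[OF m k] in measurable)
    also have "\<dots> \<le> (1 - q / 2) ^ N"
    proof (rule prob_no_block_run_le[OF m k d(1) q_def])
      fix r A B
      assume *: "r \<ge> 1" "A \<in> gen_sigma M S (proc T X) {1..r}" "B \<in> gen_sigma M S (proc T X) {r + (d - k) + 1..}"
      have "prob (A \<inter> B) - prob A * prob B \<le> C0 * \<theta> ^ (d - k) * prob A * prob B"
        using mix[OF *(1) _ *(2,3)] d(1) by (simp add: abs_le_iff Suc_le_eq)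
      also have "\<dots> \<le> q / 2 * prob A * prob B"
        using small by (intro mult_right_mono) auto
      finally show "prob (A \<inter> B) \<le> (1 + q / 2) * prob A * prob B" by (simp add: algebra_simps)
    qed
    also have "\<dots> \<le> exp (- x) ^ N"
    proof (rule power_mono)
      show "1 - q / 2 \<le> exp (- x)" using exp_ge_add_one_self[of "- x"] xq by linarith
      show "0 \<le> 1 - q / 2" using prob_le_1[of "cyl M T X k m"] unfolding q_def by linarith
    qed
    also have "\<dots> = exp (- (x * real N))" by (simp add: exp_of_nat_mult[symmetric] mult.commute)
    \<comment> \<open>Rounding in \<open>n div d\<close> loses less than one block, hence at most a
      factor \<open>exp x \<le> exp cm\<close>; this also covers \<open>n < d\<close>.\<close>
    also have "\<dots> \<le> exp (cm + - x * (real n / real d))"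
    proof -
      have "real n / real d \<le> real N + 1" using real_of_int_floor_add_one_ge[of "real n / real d"]
        by (simp add: N_def floor_divide_of_nat_eq)
      then have "x * (real n / real d) \<le> x * (real N + 1)" using x0 by (rule mult_left_mono)
      then show ?thesis using x1 by (simp add: algebra_simps)
    qed
    also have "\<dots> = exp cm * exp (- (cm / (2 * D)) * \<rho> powr (-2 * real k) * real n / real k)"
      unfolding exp_add by (simp add: x_def d_def mult_ac)
    finally show ?thesis .
  qed
  have "cm / (2 * D) > 0" using cm by (simp add: D_def)
  then show ?thesis using bound by (intro exI[of _ "exp cm"] exI[of _ "cm / (2 * D)"]) auto
qed

section \<open>Almost sure bounds for one symbol and for the maximum\<close>

lemma AE_eventually_run_length_ge:
  assumes "mixing M S (proc T X)" and m: "m \<in> S" and "\<rho> > 1" and "cyl_decay M T X \<rho> m" and "c > 1/2"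
  shows "AE \<omega> in M. \<forall>\<^sub>F n in sequentially.
    real (run_length T X n \<omega> m) \<ge> ln (real n) / (2 * ln \<rho>) - c * ln (ln (real n)) / ln \<rho>"
proof -
  obtain C a where "C > 0" "a > 0" "\<And>n k. k \<ge> 1 \<Longrightarrow> prob {\<omega>\<in>space M. run_length T X n \<omega> m < k}
      \<le> C * exp (- a * \<rho> powr (-2 * real k) * real n / real k)"
    using prob_run_length_less_le[OF assms(1-4)] by blast
  moreover have "{\<omega>\<in>space M. run_length T X n \<omega> m < k} \<in> events" if "k \<ge> 1" for n k
    using sets.compl_sets[OF run_length_ge_event[OF m that, of n]]
    by (rule back_subst[of "\<lambda>A. A \<in> events"]) auto
  ultimately show ?thesis
    using assms(3,5) by (intro AE_eventually_ge[where C = C and a = a] run_length_mono) auto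
qed

lemma AE_eventually_run_length_le:
  assumes m: "m \<in> S" and "\<rho> > 1" and decay: "cyl_decay M T X \<rho> m" and "c > 1/2"
  shows "AE \<omega> in M. \<forall>\<^sub>F n in sequentially.
    real (run_length T X n \<omega> m) \<le> ln (real n) / (2 * ln \<rho>) + c * ln (ln (real n)) / ln \<rho>"
proof -
  obtain cp where cp: "cp > 0" "\<And>k. k \<ge> 1 \<Longrightarrow> prob (cyl M T X k m) \<le> cp * \<rho> powr (-2 * real k)"
    using decay unfolding cyl_decay_def by blast
  have "prob {\<omega>\<in>space M. k \<le> run_length T X n \<omega> m} \<le> cp * real n * \<rho> powr (-2 * real k)"
    if "k \<ge> 1" for n k
    using prob_run_length_ge_le[of "{m}" k n] m that mult_left_mono[OF cp(2)[OF that], of "real n"]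
    by (simp add: mult_ac)
  then show ?thesis
    using assms(2,4) cp(1) run_length_ge_event[OF m] by (intro AE_eventually_le run_length_mono) auto
qed

lemma AE_eventually_max_run_length_le:
  assumes S: "S \<noteq> {}" and "\<rho> > 1" and decay: "cyl_sum_decay M S T X \<rho>" and "c > 1/2"
  shows "AE \<omega> in M. \<forall>\<^sub>F n in sequentially.
    real (max_run_length S T X n \<omega>) \<le> ln (real n) / (2 * ln \<rho>) + c * ln (ln (real n)) / ln \<rho>"
proof -
  obtain C where C: "C > 0" "\<And>k. k \<ge> 1 \<Longrightarrow> prob (\<Union>m\<in>S. cyl M T X k m) \<le> C * \<rho> powr (-2 * real k)"
    using decay unfolding cyl_sum_decay_def by (auto simp: prob_UN_cyl)
  have "prob {\<omega>\<in>space M. k \<le> max_run_length S T X n \<omega>} \<le> C * real n * \<rho> powr (-2 * real k)"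
    if "k \<ge> 1" for n k
    using prob_run_length_ge_le[of S k n] that mult_left_mono[OF C(2)[OF that], of "real n"]
    by (simp add: max_run_length_ge_iff[OF S] mult_ac)
  moreover have "{\<omega>\<in>space M. k \<le> max_run_length S T X n \<omega>} \<in> events" if "k \<ge> 1" for n k
  proof -
    have "{\<omega>\<in>space M. k \<le> max_run_length S T X n \<omega>} = (\<Union>m\<in>S. {\<omega>\<in>space M. k \<le> run_length T X n \<omega> m})"
      by (auto simp: max_run_length_ge_iff[OF S])
    also have "\<dots> \<in> events"
      using that run_length_ge_event by (intro sets.countable_UN'' countable_S) auto
    finally show ?thesis .
  qed
  ultimately show ?thesis
    using assms(2,4) C(1) by (intro AE_eventually_le max_run_length_mono[OF S]) auto
qed

end

text \<open>Bridges the threshold in \<open>theorem1\<close>, taken from the positive integers, and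
  the filter form in which upper and lower bounds are intersected.\<close>

lemma eventually_sequentially_ge1:
  "(\<exists>n0\<ge>1. \<forall>n\<ge>n0. P n) \<longleftrightarrow> eventually P sequentially" for P :: "nat \<Rightarrow> bool"
  unfolding eventually_sequentially by (meson le_trans max.cobounded1 max.cobounded2)

theorem theorem1:
  fixes M :: "'w measure" and T :: "'w \<Rightarrow> 'w" and S :: "'a set" and X :: "'w \<Rightarrow> 'a"
    and \<rho> :: real
  assumes "prob_space M"
    and "measure_preserving_map M T"
    and "countable S"
    and "X \<in> measurable M (count_space S)"
    and "\<rho> > 1"
    and "mixing M S (proc T X)"
  shows "(\<forall>m\<in>S. cyl_decay M T X \<rho> m \<longrightarrow>
            (\<forall>c>1/2. AE \<omega> in M. \<exists>n0\<ge>1. \<forall>n\<ge>n0.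
               \<bar>real (run_length T X n \<omega> m) - ln (real n) / (2 * ln \<rho>)\<bar>
                 \<le> c * ln (ln (real n)) / ln \<rho>))
       \<and> ((\<exists>m\<in>S. cyl_decay M T X \<rho> m) \<and> cyl_sum_decay M S T X \<rho> \<longrightarrow>
            (\<forall>c>1/2. AE \<omega> in M. \<exists>n0\<ge>1. \<forall>n\<ge>n0.
               \<bar>real (max_run_length S T X n \<omega>) - ln (real n) / (2 * ln \<rho>)\<bar>
                 \<le> c * ln (ln (real n)) / ln \<rho>))"
proof -
  interpret prob_space M by fact
  interpret stationary_process M T S X
    by unfold_locales (use assms in auto)
  show ?thesis
    unfolding eventually_sequentially_ge1
  proof (intro conjI ballI impI allI; (elim conjE bexE)?)
    fix m and c :: real assume m: "m \<in> S" "cyl_decay M T X \<rho> m" "c > 1/2"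
    show "AE \<omega> in M. \<forall>\<^sub>F n in sequentially.
        \<bar>real (run_length T X n \<omega> m) - ln (real n) / (2 * ln \<rho>)\<bar> \<le> c * ln (ln (real n)) / ln \<rho>"
      using AE_eventually_run_length_le[OF m(1) assms(5) m(2,3)]
        AE_eventually_run_length_ge[OF assms(6) m(1) assms(5) m(2,3)]
    proof eventually_elim
      case (elim \<omega>)
      then show ?case by eventually_elim (simp add: abs_le_iff)
    qed
  next
    fix m and c :: real
    assume m: "m \<in> S" "cyl_decay M T X \<rho> m" "c > 1/2" and sum: "cyl_sum_decay M S T X \<rho>"
    have S: "S \<noteq> {}" using m by auto
    show "AE \<omega> in M. \<forall>\<^sub>F n in sequentially.
        \<bar>real (max_run_length S T X n \<omega>) - ln (real n) / (2 * ln \<rho>)\<bar> \<le> c * ln (ln (real n)) / ln \<rho>"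
      using AE_eventually_max_run_length_le[OF S assms(5) sum m(3)]
        AE_eventually_run_length_ge[OF assms(6) m(1) assms(5) m(2,3)]
    proof eventually_elim
      case (elim \<omega>)
      \<comment> \<open>The lower bound for the maximum is inherited from the single symbol
        \<open>m\<close>.\<close>
      have le: "run_length T X n \<omega> m \<le> max_run_length S T X n \<omega>" for n
        by (subst max_run_length_ge_iff[OF S]) (use m in auto)
      show ?case using elim
      proof eventually_elim
        case (elim n)
        then show ?case using le[of n] by (simp add: abs_le_iff)
      qed
    qed
  qed
qed

end
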